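(* Let $(a_k)_{k\ge 0}$ be the coefficients of the asymptotic expansion $n!\asymp\sqrt{2\pi n}\,e^{-n}n^n\big(\sum_{k\ge 0}a_k/n^k\big)$ as $n\to\infty$. Let $B(x)=\sum_{k\ge 1}b_k\frac{x^k}{k!}$ and $C(x)=\sum_{k\ge 1}c_k\frac{x^k}{k!}$ be the formal power series $$B(x)=\Big(x\Big(\frac{e^x-1-x}{x^2/2}\Big)^{1/2}\Big)^{\langle -1\rangle},\qquad C(x)=\Big(x\Big(\frac{-\log(1+x)+x}{x^2/2}\Big)^{1/2}\Big)^{\langle -1\rangle},$$ and put $\tilde b_k=b_k/k!$, $\tilde c_k=c_k/k!$. Then for every integer $k\ge 0$, $$a_k=\frac{b_{2k+1}}{2^k\,k!}=\frac{c_{2k+1}}{2^k\,k!}=(2k+1)!!\,\tilde b_{2k+1}=(2k+1)!!\,\tilde c_{2k+1}.$$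
   Context: For a formal power series $R(x)=xT(x)$ with $T$ a formal power series with nonzero constant term, $R^{\langle -1\rangle}$ denotes its substitutional (compositional) inverse, i.e. $S=R^{\langle -1\rangle}$ means $R(S(x))=S(R(x))=x$. The series $\frac{e^x-1-x}{x^2/2}$ and $\frac{-\log(1+x)+x}{x^2/2}$ have constant term $1$, and the power $1/2$ denotes their formal square root with constant term $1$. $(2k+1)!!=1\cdot 3\cdots(2k+1)$. The asymptotic expansion means: for every integer $N\ge 0$, $n!=\sqrt{2\pi n}\,e^{-n}n^n\big(\sum_{k=0}^{N}a_k/n^k+R_{N+1}\big)$ with $R_{N+1}=O(n^{-(N+1)})$ as $n\to\infty$; such an expansion exists and its coefficients are unique. *)

theory Defs
  imports
    "HOL-Analysis.Analysis"
    "HOL-Computational_Algebra.Formal_Power_Series"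
    "HOL-Library.Landau_Symbols"
begin

definition stirling_expansion :: "(nat \<Rightarrow> real) \<Rightarrow> bool" where
  "stirling_expansion a \<longleftrightarrow>
     (\<forall>N. \<exists>R :: nat \<Rightarrow> real.
        R \<in> O(\<lambda>n. 1 / real n ^ (N + 1)) \<and>
        (\<forall>n\<ge>1. fact n =
           sqrt (2 * pi * real n) * exp (- real n) * real n ^ n *
             ((\<Sum>k=0..N. a k / real n ^ k) + R n)))"

text \<open>
  For a series with constant term 1, this is the square root with constant term 1,
  because \<open>root 2 1 = 1\<close>.
\<close>
definition fps_sqrt :: "real fps \<Rightarrow> real fps" where
  "fps_sqrt f = fps_radical root 2 f"

definition exp_quotient :: "real fps" where
  "exp_quotient = (fps_exp 1 - 1 - fps_X) / (fps_X ^ 2 / 2)"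

text \<open>\<^term>\<open>fps_ln 1\<close> is the series of \<open>log (1 + x)\<close>.\<close>
definition log_quotient :: "real fps" where
  "log_quotient = (- fps_ln 1 + fps_X) / (fps_X ^ 2 / 2)"

text \<open>\<^const>\<open>fps_inv\<close> is the compositional inverse.\<close>
definition B_series :: "real fps" where
  "B_series = fps_inv (fps_X * fps_sqrt exp_quotient)"

definition C_series :: "real fps" where
  "C_series = fps_inv (fps_X * fps_sqrt log_quotient)"

definition b_coeff :: "nat \<Rightarrow> real" where
  "b_coeff k = fact k * fps_nth B_series k"

definition c_coeff :: "nat \<Rightarrow> real" where
  "c_coeff k = fact k * fps_nth C_series k"

definition b_tilde :: "nat \<Rightarrow> real" where
  "b_tilde k = b_coeff k / fact k"

definition c_tilde :: "nat \<Rightarrow> real" where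
  "c_tilde k = c_coeff k / fact k"

definition odd_double_fact :: "nat \<Rightarrow> nat" where
  "odd_double_fact k = (\<Prod>i=0..k. 2 * i + 1)"

text \<open>
  The library's division, radical and compositional inverse of formal power series are total
  functions; the following facts confirm that they are used here within their proper domain.
\<close>

lemma half_X_squared:
  "(fps_X ^ 2 / 2 :: real fps) = fps_const (1/2) * fps_X ^ 2"
  by (simp add: fps_divide_unit fps_const_inverse numeral_fps_const mult.commute)

lemma quotient_mult:
  fixes f :: "real fps"
  assumes "fps_nth f 0 = 0" "fps_nth f 1 = 0"
  shows "f / (fps_X ^ 2 / 2) * (fps_X ^ 2 / 2) = f"
    and "fps_nth (f / (fps_X ^ 2 / 2)) n = 2 * fps_nth f (n + 2)"
proof -
  define g :: "real fps" where "g = Abs_fps (\<lambda>n. 2 * fps_nth f (n + 2))"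
  have nz: "(fps_X ^ 2 / 2 :: real fps) \<noteq> 0"
    by (simp add: half_X_squared)
  have eq: "f = g * (fps_X ^ 2 / 2)"
  proof (rule fps_ext)
    fix n :: nat
    consider "n = 0" | "n = 1" | m where "n = m + 2"
      by (metis One_nat_def add_2_eq_Suc' not0_implies_Suc)
    then show "fps_nth f n = fps_nth (g * (fps_X ^ 2 / 2)) n"
      using assms unfolding half_X_squared g_def
      by cases (auto simp: mult.left_commute[of _ "fps_const _"] fps_X_power_mult_right_nth)
  qed
  then have "f / (fps_X ^ 2 / 2) = g"
    using nz by (metis nonzero_mult_div_cancel_right)
  moreover have "fps_nth g n = 2 * fps_nth f (n + 2)"
    by (simp add: g_def)
  ultimately show "f / (fps_X ^ 2 / 2) * (fps_X ^ 2 / 2) = f"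
    and "fps_nth (f / (fps_X ^ 2 / 2)) n = 2 * fps_nth f (n + 2)"
    using eq by metis+
qed

lemma exp_quotient_mult: "exp_quotient * (fps_X ^ 2 / 2) = fps_exp 1 - 1 - fps_X"
  unfolding exp_quotient_def by (rule quotient_mult(1)) simp_all

lemma log_quotient_mult: "log_quotient * (fps_X ^ 2 / 2) = - fps_ln 1 + fps_X"
  unfolding log_quotient_def by (rule quotient_mult(1)) (simp_all add: fps_ln_def)

lemma exp_quotient_nth_0: "fps_nth exp_quotient 0 = 1"
  unfolding exp_quotient_def by (subst quotient_mult(2)) simp_all

lemma log_quotient_nth_0: "fps_nth log_quotient 0 = 1"
  unfolding log_quotient_def
  by (subst quotient_mult(2)) (simp_all add: fps_ln_def)

lemma fps_sqrt_nth_0: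
  assumes "fps_nth f 0 = 1"
  shows "fps_nth (fps_sqrt f) 0 = 1"
  using assms by (simp add: fps_sqrt_def)

lemma fps_sqrt_power2:
  assumes "fps_nth f 0 = 1"
  shows "fps_sqrt f ^ 2 = f"
proof -
  have "root (Suc 1) (fps_nth f 0) ^ Suc 1 = fps_nth f 0"
    using assms by simp
  moreover have "fps_nth f 0 \<noteq> 0"
    using assms by simp
  ultimately have "fps_radical root (Suc 1) f ^ Suc 1 = f"
    using power_radical[of f root 1] by blast
  then show ?thesis
    unfolding fps_sqrt_def Suc_1 .
qed

lemma B_series_inverse:
  "(fps_X * fps_sqrt exp_quotient) oo B_series = fps_X"
  "B_series oo (fps_X * fps_sqrt exp_quotient) = fps_X"
  unfolding B_series_def
  by (auto intro!: fps_inv fps_inv_right simp: fps_sqrt_nth_0 exp_quotient_nth_0)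

lemma C_series_inverse:
  "(fps_X * fps_sqrt log_quotient) oo C_series = fps_X"
  "C_series oo (fps_X * fps_sqrt log_quotient) = fps_X"
  unfolding C_series_def
  by (auto intro!: fps_inv fps_inv_right simp: fps_sqrt_nth_0 log_quotient_nth_0)

end

theory Submission
  imports
    Defs
    "HOL-Probability.Distributions"
    "HOL-Computational_Algebra.Polynomial_FPS"
begin

text \<open>
  The proof is Laplace's method carried out with a polynomial change of variables.
  Substituting \<open>t = n e\<^sup>y\<close> in Euler's integral for \<open>\<Gamma> n\<close> gives
  \<open>n! = n\<^bsup>n+1\<^esup> e\<^bsup>-n\<^esup> \<integral> exp (-n (e\<^sup>y - 1 - y)) dy\<close> over the real line
  (\<open>fact_eq_integral_exp\<close>). The defining equation of \<open>B\<close> says \<open>exp B(u) - 1 - B(u) = u\<^sup>2/2\<close>, so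
  formally \<open>y = B(u)\<close> turns the integral into \<open>\<integral> B'(u) exp (-n u\<^sup>2/2) du\<close>. There the odd terms
  of \<open>B'\<close> integrate to \<open>0\<close>, and the even moments of the Gaussian give
  \<open>sqrt (2\<pi>/n) \<Sum>\<^sub>k b\<^bsub>2k+1\<^esub> / (2\<^sup>k k! n\<^sup>k)\<close>.

  To make this rigorous no convergence of \<open>B\<close> is needed. For the expansion up to \<open>n\<^bsup>-N\<^esup>\<close>, \<open>B\<close>
  is replaced by its truncation \<open>p\<close> after degree \<open>2N + 2\<close>, for which
  \<open>exp p(u) - 1 - p(u) = u\<^sup>2/2 + O(u\<^bsup>2N+4\<^esup>)\<close> (\<open>B_trunc_exp_coeff\<close>, \<open>exp_poly_remainder\<close>). The
  substitution \<open>y = p(u)\<close> is made near \<open>0\<close> only (\<open>exp_phase_local_expansion\<close>), and the rest of the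
  integral is negligible (\<open>exp_phase_tail\<close>). So the numbers \<open>b\<^bsub>2k+1\<^esub> / (2\<^sup>k k!)\<close> are coefficients
  of an asymptotic expansion of \<open>n!\<close> (\<open>stirling_expansion_stirling_coeff\<close>), and such
  coefficients are unique (\<open>stirling_expansion_unique\<close>).

  The equality with the \<open>c\<^bsub>2k+1\<^esub>\<close> is formal: \<open>C = exp B - 1 = B + x\<^sup>2/2\<close>
  (\<open>C_series_eq_B_series\<close>), so \<open>B\<close> and \<open>C\<close> differ only in degree \<open>2\<close>.
\<close>

section \<open>The formal power series B and C\<close>

lemma fps_nth_sqrt_mult_1:
  assumes "fps_nth f 0 = 1"
  shows "fps_nth (fps_X * fps_sqrt f) 0 = 0" "fps_nth (fps_X * fps_sqrt f) 1 = 1"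
  using fps_sqrt_nth_0[OF assms] by simp_all

lemma fps_nth_inverse_pair_1:
  fixes F G :: "real fps"
  assumes "F oo G = fps_X" "fps_nth F 1 = 1" "fps_nth F 0 = 0"
  shows "fps_nth G 1 = 1"
proof -
  have "fps_nth (F oo G) 1 = 1" using assms by simp
  then show ?thesis using assms(2,3) by (simp add: fps_compose_nth)
qed

lemma B_series_nth_0 [simp]: "fps_nth B_series 0 = 0"
  by (simp add: B_series_def fps_inv_def)

lemma B_series_nth_1 [simp]: "fps_nth B_series (Suc 0) = 1"
  using fps_nth_inverse_pair_1[OF B_series_inverse(1)]
    fps_nth_sqrt_mult_1[OF exp_quotient_nth_0] by simp

lemma X_sqrt_squared:
  assumes "fps_nth f 0 = 1" "f * (fps_X ^ 2 / 2) = g"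
  shows "(fps_X * fps_sqrt f) ^ 2 = fps_const 2 * g"
proof -
  have "(fps_X * fps_sqrt f) ^ 2 = fps_X ^ 2 * f"
    by (simp add: power_mult_distrib fps_sqrt_power2[OF assms(1)])
  also have "\<dots> = (fps_const 2 * fps_const (1/2)) * (fps_X ^ 2 * f)"
    by (simp only: fps_const_mult) simp
  also have "\<dots> = fps_const 2 * g"
    unfolding assms(2)[symmetric] half_X_squared by (simp only: ac_simps)
  finally show ?thesis .
qed

lemma fps_compose_const_mult:
  fixes f g :: "real fps"
  assumes "fps_nth g 0 = 0"
  shows "(fps_const c * f) oo g = fps_const c * (f oo g)"
  using assms by (simp add: fps_compose_mult_distrib)

lemma fps_X_squared_cancel:
  fixes f :: "real fps"
  assumes "fps_X ^ 2 = fps_const 2 * f"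
  shows "f = fps_const (1/2) * fps_X ^ 2"
  by (simp add: assms mult.assoc[symmetric])

text \<open>
  The series of \<open>B\<close> is the formal change of variables turning \<open>e\<^sup>y - 1 - y\<close> into \<open>u\<^sup>2/2\<close>.
\<close>
lemma exp_compose_B_series:
  "(fps_exp 1 - 1 - fps_X) oo B_series = fps_const (1/2) * fps_X ^ 2"
proof -
  let ?L = "fps_X * fps_sqrt exp_quotient"
  have "fps_X ^ 2 = (?L ^ 2) oo B_series"
    by (simp only: fps_compose_power[symmetric, OF B_series_nth_0] B_series_inverse)
  also have "\<dots> = fps_const 2 * ((fps_exp 1 - 1 - fps_X) oo B_series)"
    by (simp only: X_sqrt_squared[OF exp_quotient_nth_0 exp_quotient_mult]
        fps_compose_const_mult[OF B_series_nth_0])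
  finally show ?thesis by (rule fps_X_squared_cancel)
qed

text \<open>
  Put \<open>D = exp B - 1\<close>. Then \<open>log (1 + D) = B\<close>, so \<open>D - log (1 + D) = exp B - 1 - B = x\<^sup>2/2\<close>.
  This says that \<open>D\<close> solves the equation characterising \<open>C\<close> up to a sign, and the linear
  coefficient fixes the sign. Hence \<open>C = exp B - 1 = B + x\<^sup>2/2\<close>.
\<close>
lemma C_series_eq_B_series: "C_series = B_series + fps_const (1/2) * fps_X ^ 2"
proof -
  let ?L = "fps_X * fps_sqrt log_quotient"
  let ?E = "fps_exp 1 - 1 :: real fps"
  define D where "D = ?E oo B_series"
  have D: "D = B_series + fps_const (1/2) * fps_X ^ 2"
    using exp_compose_B_series by (simp add: D_def fps_compose_sub_distrib diff_eq_eq add.commute)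
  have D0: "fps_nth D 0 = 0" and D1: "fps_nth D 1 = 1"
    unfolding D by (simp_all)
  have "fps_ln 1 oo D = (fps_ln 1 oo ?E) oo B_series"
    unfolding D_def by (rule fps_compose_assoc) simp_all
  also have "fps_ln 1 oo ?E = fps_X"
    unfolding fps_ln_fps_exp_inv[of 1, simplified] by (rule fps_inv) simp_all
  finally have ln_D: "fps_ln 1 oo D = B_series" by simp
  have "(?L oo D) ^ 2 = (?L ^ 2) oo D"
    by (rule fps_compose_power[OF D0])
  also have "\<dots> = fps_const 2 * ((- fps_ln 1 + fps_X) oo D)"
    by (simp only: X_sqrt_squared[OF log_quotient_nth_0 log_quotient_mult]
        fps_compose_const_mult[OF D0])
  also have "\<dots> = fps_const 2 * (fps_const (1/2) * fps_X ^ 2)"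
    by (simp only: fps_compose_add_distrib fps_compose_uminus ln_D fps_X_fps_compose_startby0[OF D0])
       (simp add: D)
  also have "\<dots> = fps_X ^ 2"
    by (simp add: mult.assoc[symmetric])
  finally have "?L oo D = fps_X \<or> ?L oo D = - fps_X"
    by (simp add: power2_eq_iff)
  moreover have "fps_nth (?L oo D) 1 = 1"
    using D1 fps_nth_sqrt_mult_1[OF log_quotient_nth_0] by (simp add: fps_compose_nth)
  ultimately have LD: "?L oo D = fps_X" by auto
  have "C_series = C_series oo (?L oo D)" by (simp add: LD)
  also have "\<dots> = (C_series oo ?L) oo D"
    by (rule fps_compose_assoc) (simp_all add: D0)
  also have "\<dots> = D" by (simp add: C_series_inverse D0)
  finally show ?thesis using D by simp
qed

lemma c_coeff_odd: "c_coeff (2 * k + 1) = b_coeff (2 * k + 1)"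
  by (simp add: c_coeff_def b_coeff_def C_series_eq_B_series)

text \<open>
  Agreement of two series without constant term up to order \<open>M\<close> gains one order in all powers
  from the square on, because in \<open>F\<^sup>i - G\<^sup>i = (F - G) \<Sum>\<^sub>j G\<^bsup>i-1-j\<^esup> F\<^sup>j\<close> every summand
  is divisible by \<open>x\<close>.
\<close>
lemma fps_power_nth_cong:
  fixes F G :: "real fps"
  assumes F0: "fps_nth F 0 = 0" and eq: "\<And>j. j \<le> M \<Longrightarrow> fps_nth F j = fps_nth G j"
    and i: "i \<ge> 2" and n: "n < M + 2"
  shows "fps_nth (F ^ i) n = fps_nth (G ^ i) n"
proof -
  have dvd_iff: "fps_X ^ k dvd h \<longleftrightarrow> (\<forall>m<k. fps_nth h m = 0)" for k and h :: "real fps"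
    by (cases "h = 0") (auto simp: fps_dvd_iff intro: subdegree_geI nth_less_subdegree_zero)
  have G0: "fps_nth G 0 = 0" using F0 eq[of 0] by simp
  have FX: "fps_X dvd F" "fps_X dvd G"
    using dvd_iff[of 1] F0 G0 by simp_all
  have "fps_X ^ (M + 1) dvd F - G"
    unfolding dvd_iff using eq by auto
  moreover have "fps_X dvd (\<Sum>j<i. G ^ (i - Suc j) * F ^ j)"
  proof (rule dvd_sum)
    fix j assume "j \<in> {..<i}"
    with i have "i - Suc j > 0 \<or> j > 0" by auto
    then show "fps_X dvd G ^ (i - Suc j) * F ^ j"
      using FX by (metis dvd_mult dvd_mult2 dvd_power_same dvd_power dvd_trans)
  qed
  ultimately have "fps_X ^ (M + 1) * fps_X dvd F ^ i - G ^ i"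
    unfolding power_diff_sumr2 by (rule mult_dvd_mono)
  then have "fps_X ^ (M + 2) dvd F ^ i - G ^ i" by (simp add: mult.commute)
  with n show ?thesis unfolding dvd_iff by auto
qed

text \<open>The polynomial consisting of the terms of \<open>B\<close> of degree at most \<open>M\<close>.\<close>
definition B_trunc :: "nat \<Rightarrow> real poly" where
  "B_trunc M = truncate_fps (M + 1) B_series"

lemma coeff_B_trunc: "coeff (B_trunc M) j = (if j \<le> M then fps_nth B_series j else 0)"
  by (auto simp: B_trunc_def coeff_truncate_fps' coeff_truncate_fps)

text \<open>
  The Taylor polynomial of \<open>e\<^sup>y - 1 - y\<close> at the truncated series is \<open>u\<^sup>2/2\<close> up to terms of order
  \<open>M + 2\<close>.
\<close>
lemma B_trunc_exp_coeff:
  assumes "n < M + 2"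
  shows "coeff (\<Sum>j=2..<M+2. smult (1 / fact j) (B_trunc M ^ j)) n = coeff (monom (1/2) 2) n"
proof -
  let ?\<phi> = "fps_exp 1 - 1 - fps_X :: real fps"
  have "coeff (\<Sum>j=2..<M+2. smult (1 / fact j) (B_trunc M ^ j)) n =
        (\<Sum>j=2..<M+2. 1 / fact j * fps_nth (fps_of_poly (B_trunc M) ^ j) n)"
    by (simp add: coeff_sum fps_of_poly_power[symmetric])
  also have "\<dots> = (\<Sum>j=2..<M+2. 1 / fact j * fps_nth (B_series ^ j) n)"
    by (intro sum.cong refl arg_cong[where f = "(*) _"]
        fps_power_nth_cong[of _ M, symmetric] assms)
       (simp_all add: coeff_B_trunc)
  also have "\<dots> = (\<Sum>j=0..n. fps_nth ?\<phi> j * fps_nth (B_series ^ j) n)"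
  proof (rule sum.mono_neutral_cong)
    fix j assume "j \<in> {0..n} - {2..<M + 2}"
    with assms have "j = 0 \<or> j = 1" by auto
    then show "fps_nth ?\<phi> j * fps_nth (B_series ^ j) n = 0" by auto
  next
    fix j assume "j \<in> {2..<M + 2} - {0..n}"
    then show "1 / fact j * fps_nth (B_series ^ j) n = 0"
      using startsby_zero_power_prefix[of B_series j] by auto
  qed auto
  also have "\<dots> = fps_nth (?\<phi> oo B_series) n"
    by (simp add: fps_compose_nth)
  also have "\<dots> = coeff (monom (1/2) 2) n"
    unfolding exp_compose_B_series by auto
  finally show ?thesis .
qed

section \<open>Integral representation of the factorial and Gaussian integrals\<close>

text \<open>
  Substitute \<open>t = n e\<^sup>y\<close> in \<open>\<Gamma> n = \<integral> t\<^bsup>n-1\<^esup> e\<^bsup>-t\<^esup> dt\<close>. Starting from \<open>\<Gamma> n\<close> rather than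
  \<open>\<Gamma> (n + 1)\<close> leaves no factor \<open>e\<^sup>y\<close> in front of the exponential.
\<close>
lemma fact_eq_integral_exp:
  fixes n :: nat
  assumes "n \<ge> 1"
  shows "((\<lambda>y::real. exp (- real n * (exp y - 1 - y))) has_integral
           fact n * exp (real n) / real n ^ (n + 1)) UNIV"
proof -
  let ?f = "\<lambda>t::real. t powr (real n - 1) / exp t"
  let ?g = "\<lambda>y::real. real n * exp y"
  have n: "real n > 0" using assms by simp
  have "(?f has_integral Gamma (real n)) {0..}"
    by (rule Gamma_integral_real[OF n])
  then have "((\<lambda>t. if t \<in> {0<..} then ?f t else 0) has_integral Gamma (real n)) {0..}"
    by (rule has_integral_spike[of "{0}", rotated 2]) auto
  then have f: "(?f has_integral Gamma (real n)) {0<..}"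
    by (subst (asm) has_integral_restrict) auto
  then have f_abs: "?f absolutely_integrable_on {0<..}"
    by (intro nonnegative_absolutely_integrable_1) (auto simp: has_integral_iff)
  have img: "range ?g = {0<..}"
  proof (intro equalityI subsetI)
    fix t :: real assume "t \<in> {0<..}"
    with n have "t = ?g (ln (t / real n))" by simp
    then show "t \<in> range ?g" by blast
  qed (use n in auto)
  have "inj ?g" using n by (auto simp: inj_def)
  then have "(\<lambda>y. \<bar>?g y\<bar> * ?f (?g y)) absolutely_integrable_on UNIV \<and>
      integral UNIV (\<lambda>y. \<bar>?g y\<bar> * ?f (?g y)) = Gamma (real n)"
    using f f_abs img
    by (subst has_absolute_integral_change_of_variables_1'[where g = ?g])
       (auto intro!: derivative_eq_intros simp: has_integral_iff)
  then have "((\<lambda>y. \<bar>?g y\<bar> * ?f (?g y)) has_integral Gamma (real n)) UNIV"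
    by (auto simp: has_integral_iff set_lebesgue_integral_eq_integral)
  moreover have "\<bar>?g y\<bar> * ?f (?g y) =
      (real n ^ n * exp (- real n)) * exp (- real n * (exp y - 1 - y))" for y
  proof -
    have "\<bar>?g y\<bar> * ?g y powr (real n - 1) = ?g y powr real n"
      using n by (simp add: powr_diff)
    also have "\<dots> = real n ^ n * exp (real n * y)"
      using n by (simp add: powr_realpow power_mult_distrib exp_of_nat_mult)
    finally show ?thesis
      by (simp add: field_simps exp_minus exp_diff exp_add)
  qed
  ultimately have "((\<lambda>y. (real n ^ n * exp (- real n)) * exp (- real n * (exp y - 1 - y)))
      has_integral Gamma (real n)) UNIV"
    by simp
  then have "((\<lambda>y. exp (- real n * (exp y - 1 - y))) has_integral
      Gamma (real n) / (real n ^ n * exp (- real n))) UNIV"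
    using n by (subst (asm) has_integral_mult_right_iff) auto
  moreover have "Gamma (real n) = fact n / real n"
    using assms Gamma_fact[of "n - 1", where 'a = real] fact_reduce[of n, where 'a = real]
    by (simp add: field_simps of_nat_diff)
  ultimately show ?thesis
    by (simp add: exp_minus field_simps)
qed

lemma has_bochner_integral_lborel_imp_has_integral:
  fixes f :: "'a::euclidean_space \<Rightarrow> 'b::euclidean_space"
  shows "has_bochner_integral lborel f I \<Longrightarrow> (f has_integral I) UNIV"
  using has_integral_integral_lborel[of f] by (auto simp: has_bochner_integral_iff)

lemma gaussian_moment_even:
  fixes s :: real
  assumes "s > 0"
  shows "((\<lambda>u. exp (- s * u\<^sup>2 / 2) * u ^ (2 * k)) has_integral
           sqrt (2 * pi / s) * (fact (2 * k) / ((2 * s) ^ k * fact k))) UNIV"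
proof -
  have "((\<lambda>u. normal_density 0 (sqrt (1 / s)) u * (u - 0) ^ (2 * k)) has_integral
      fact (2 * k) / ((2 / (sqrt (1 / s))\<^sup>2) ^ k * fact k)) UNIV"
    by (intro has_bochner_integral_lborel_imp_has_integral normal_moment_even)
       (use assms in simp)
  then have "((\<lambda>u. sqrt (2 * pi / s) * (normal_density 0 (sqrt (1 / s)) u * u ^ (2 * k)))
      has_integral sqrt (2 * pi / s) * (fact (2 * k) / ((2 * s) ^ k * fact k))) UNIV"
    using assms by (intro has_integral_mult_right) simp
  then show ?thesis
    using assms by (simp add: normal_density_def field_simps)
qed


lemma gaussian_moment_odd:
  fixes s :: real
  assumes "s > 0"
  shows "((\<lambda>u. exp (- s * u\<^sup>2 / 2) * u ^ (2 * k + 1)) has_integral 0) UNIV"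
proof -
  have "((\<lambda>u. normal_density 0 (sqrt (1 / s)) u * (u - 0) ^ (2 * k + 1)) has_integral 0) UNIV"
    by (intro has_bochner_integral_lborel_imp_has_integral normal_moment_odd)
       (use assms in simp)
  then have "((\<lambda>u. sqrt (2 * pi / s) * (normal_density 0 (sqrt (1 / s)) u * u ^ (2 * k + 1)))
      has_integral sqrt (2 * pi / s) * 0) UNIV"
    by (intro has_integral_mult_right) simp
  then show ?thesis
    using assms by (simp add: normal_density_def field_simps)
qed

lemma sum_lessThan_double:
  fixes f :: "nat \<Rightarrow> 'a::comm_monoid_add"
  shows "(\<Sum>i<2 * n. f i) = (\<Sum>k<n. f (2 * k) + f (2 * k + 1))"
  by (induction n) (simp_all add: add.assoc)

lemma gaussian_integral_poly:
  fixes p :: "real poly" and s :: real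
  assumes "s > 0" "degree p < 2 * n"
  shows "((\<lambda>u. exp (- s * u\<^sup>2 / 2) * poly p u) has_integral
           sqrt (2 * pi / s) * (\<Sum>k<n. coeff p (2 * k) * fact (2 * k) / ((2 * s) ^ k * fact k))) UNIV"
proof -
  have p: "poly p u = (\<Sum>k<n. coeff p (2 * k) * u ^ (2 * k) +
      coeff p (2 * k + 1) * u ^ (2 * k + 1))" for u
  proof -
    have "poly p u = (\<Sum>i<2 * n. coeff p i * u ^ i)"
      unfolding poly_altdef using assms(2)
      by (intro sum.mono_neutral_left) (auto simp: coeff_eq_0)
    then show ?thesis unfolding sum_lessThan_double .
  qed
  have "((\<lambda>u. \<Sum>k<n. coeff p (2 * k) * (exp (- s * u\<^sup>2 / 2) * u ^ (2 * k)) +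
            coeff p (2 * k + 1) * (exp (- s * u\<^sup>2 / 2) * u ^ (2 * k + 1)))
      has_integral (\<Sum>k<n. coeff p (2 * k) *
         (sqrt (2 * pi / s) * (fact (2 * k) / ((2 * s) ^ k * fact k))) +
         coeff p (2 * k + 1) * 0)) UNIV"
    by (intro has_integral_sum finite_lessThan has_integral_add has_integral_mult_right
        gaussian_moment_even gaussian_moment_odd assms(1))
  then show ?thesis
    by (simp add: p sum_distrib_left algebra_simps)
qed

section \<open>Bounds for polynomials and for the phase\<close>

lemma poly_bounded_unit_interval:
  fixes p :: "real poly"
  obtains K where "K \<ge> 0" "\<And>u. \<bar>u\<bar> \<le> 1 \<Longrightarrow> \<bar>poly p u\<bar> \<le> K"
proof -
  have "compact (poly p ` {-1..1})"
    by (intro compact_continuous_image continuous_intros) auto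
  then obtain K where "\<forall>u\<in>{-1..1}. \<bar>poly p u\<bar> \<le> K"
    by (auto dest!: compact_imp_bounded simp: bounded_iff)
  then show thesis
    by (intro that[of "max K 0"]) (auto simp: abs_le_iff intro: max.coboundedI1)
qed

lemma poly_bound_outside:
  fixes p :: "real poly"
  assumes "degree p \<le> m" "d > 0"
  obtains K where "K \<ge> 0" "\<And>u. \<bar>u\<bar> \<ge> d \<Longrightarrow> \<bar>poly p u\<bar> \<le> K * \<bar>u\<bar> ^ m"
proof (rule that)
  let ?K = "\<Sum>i\<le>degree p. \<bar>coeff p i\<bar> / d ^ (m - i)"
  show "?K \<ge> 0" using assms by (intro sum_nonneg) auto
  fix u :: real assume u: "\<bar>u\<bar> \<ge> d"
  have "\<bar>poly p u\<bar> \<le> (\<Sum>i\<le>degree p. \<bar>coeff p i * u ^ i\<bar>)"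
    unfolding poly_altdef by (rule sum_abs)
  also have "\<dots> \<le> (\<Sum>i\<le>degree p. \<bar>coeff p i\<bar> / d ^ (m - i) * \<bar>u\<bar> ^ m)"
  proof (rule sum_mono)
    fix i assume "i \<in> {..degree p}"
    then have m: "m = (m - i) + i" using assms by simp
    have "d ^ (m - i) \<le> \<bar>u\<bar> ^ (m - i)" using u assms by (intro power_mono) auto
    then have "\<bar>u\<bar> ^ i * d ^ (m - i) \<le> \<bar>u\<bar> ^ m"
      by (subst (2) m) (simp add: power_add mult.commute mult_left_mono)
    then have "\<bar>u\<bar> ^ i \<le> \<bar>u\<bar> ^ m / d ^ (m - i)"
      using assms by (simp add: pos_le_divide_eq)
    then have "\<bar>coeff p i\<bar> * \<bar>u\<bar> ^ i \<le> \<bar>coeff p i\<bar> * (\<bar>u\<bar> ^ m / d ^ (m - i))"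
      by (rule mult_left_mono) simp
    then show "\<bar>coeff p i * u ^ i\<bar> \<le> \<bar>coeff p i\<bar> / d ^ (m - i) * \<bar>u\<bar> ^ m"
      by (simp add: abs_mult power_abs)
  qed
  finally show "\<bar>poly p u\<bar> \<le> ?K * \<bar>u\<bar> ^ m"
    by (simp add: sum_distrib_right)
qed

text \<open>
  If the Taylor polynomial of \<open>e\<^sup>y - 1 - y\<close> at \<open>y = p(u)\<close> agrees with \<open>u\<^sup>2/2\<close> to order \<open>M\<close>, then so
  does the function itself, with a uniform bound on the unit interval.
\<close>
lemma exp_poly_remainder:
  fixes p :: "real poly"
  assumes p0: "coeff p 0 = 0" and M: "M \<ge> 2"
    and coeffs: "\<And>n. n < M \<Longrightarrow>
      coeff (\<Sum>j=2..<M. smult (1 / fact j) (p ^ j)) n = coeff (monom (1/2) 2) n"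
  obtains K where "K \<ge> 0"
    "\<And>u. \<bar>u\<bar> \<le> 1 \<Longrightarrow> \<bar>exp (poly p u) - 1 - poly p u - u\<^sup>2 / 2\<bar> \<le> K * \<bar>u\<bar> ^ M"
proof -
  let ?q = "(\<Sum>j=2..<M. smult (1 / fact j) (p ^ j)) - monom (1/2) 2"
  have "monom 1 M dvd ?q"
    unfolding monom_1_dvd_iff' using coeffs by simp
  then obtain r where r: "?q = monom 1 M * r" by (auto elim: dvdE)
  have "monom 1 1 dvd p"
    unfolding monom_1_dvd_iff' using p0 by simp
  then obtain t where t: "p = monom 1 1 * t" by (auto elim: dvdE)
  obtain R where R: "R \<ge> 0" "\<And>u. \<bar>u\<bar> \<le> 1 \<Longrightarrow> \<bar>poly r u\<bar> \<le> R"
    using poly_bounded_unit_interval[of r] by blast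
  obtain T where T: "T \<ge> 0" "\<And>u. \<bar>u\<bar> \<le> 1 \<Longrightarrow> \<bar>poly t u\<bar> \<le> T"
    using poly_bounded_unit_interval[of t] by blast
  show thesis
  proof (rule that[of "R + exp T * T ^ M"])
    show "R + exp T * T ^ M \<ge> 0" using R T by simp
    fix u :: real assume u: "\<bar>u\<bar> \<le> 1"
    let ?y = "poly p u"
    have y: "\<bar>?y\<bar> \<le> T * \<bar>u\<bar>"
      using T(2)[OF u] by (simp add: t poly_monom abs_mult mult_right_mono mult.commute[of T] mult_left_mono)
    also have "\<dots> \<le> T" using u T(1) by (simp add: mult_left_le)
    finally have y': "\<bar>?y\<bar> \<le> T" .
    obtain \<theta> where \<theta>: "\<bar>\<theta>\<bar> \<le> \<bar>?y\<bar>"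
      "exp ?y = (\<Sum>m<M. ?y ^ m / fact m) + exp \<theta> / fact M * ?y ^ M"
      using Maclaurin_exp_le[of ?y M] by blast
    have "(\<Sum>m<M. ?y ^ m / fact m) = (\<Sum>m\<in>{0,1} \<union> {2..<M}. ?y ^ m / fact m)"
      using M by (intro sum.cong) auto
    also have "\<dots> = 1 + ?y + (\<Sum>m=2..<M. ?y ^ m / fact m)"
      by (subst sum.union_disjoint) auto
    finally have "exp ?y - 1 - ?y - u\<^sup>2 / 2 = poly ?q u + exp \<theta> / fact M * ?y ^ M"
      using \<theta>(2) by (simp add: poly_sum poly_monom)
    also have "poly ?q u = u ^ M * poly r u"
      unfolding r by (simp add: poly_monom)
    also have "\<bar>u ^ M * poly r u + exp \<theta> / fact M * ?y ^ M\<bar>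
        \<le> R * \<bar>u\<bar> ^ M + exp T * (T * \<bar>u\<bar>) ^ M"
    proof (rule order_trans[OF abs_triangle_ineq add_mono])
      show "\<bar>u ^ M * poly r u\<bar> \<le> R * \<bar>u\<bar> ^ M"
        unfolding abs_mult power_abs using R(2)[OF u]
        by (subst mult.commute) (rule mult_right_mono, auto)
      have "exp \<theta> / fact M \<le> exp T / 1"
        using \<theta>(1) y' by (intro frac_le fact_ge_1) auto
      moreover have "\<bar>?y\<bar> ^ M \<le> (T * \<bar>u\<bar>) ^ M"
        by (rule power_mono[OF y]) simp
      ultimately show "\<bar>exp \<theta> / fact M * ?y ^ M\<bar> \<le> exp T * (T * \<bar>u\<bar>) ^ M"
        unfolding abs_mult power_abs by (intro mult_mono) auto
    qed
    also have "\<dots> = (R + exp T * T ^ M) * \<bar>u\<bar> ^ M"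
      by (simp only: power_mult_distrib distrib_right mult.assoc)
    finally show "\<bar>exp ?y - 1 - ?y - u\<^sup>2 / 2\<bar> \<le> (R + exp T * T ^ M) * \<bar>u\<bar> ^ M" .
  qed
qed

lemma exp_phase_mono:
  fixes y q :: real
  assumes "0 \<le> q \<and> q \<le> y \<or> y \<le> q \<and> q \<le> 0"
  shows "exp q - 1 - q \<le> exp y - 1 - y"
proof -
  have "(exp q - 1) * (y - q) \<ge> 0"
    using assms by (auto intro: mult_nonneg_nonneg mult_nonpos_nonpos)
  moreover have "exp q * (1 + (y - q)) \<le> exp q * exp (y - q)"
    by (intro mult_left_mono exp_ge_add_one_self) simp
  moreover have "exp q * exp (y - q) = exp y" by (simp add: exp_diff)
  ultimately show ?thesis by (simp add: algebra_simps)
qed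

lemma exp_phase_pos:
  fixes y :: real
  assumes "y \<noteq> 0"
  shows "exp y - 1 - y > 0"
  using exp_ge_add_one_self[of y] ln_eq_minus_one[of "exp y"] assms
  by (metis add_diff_cancel_left' diff_diff_eq diff_gt_0_iff_gt exp_gt_zero exp_inj_iff exp_zero
      ln_exp order_le_less)

lemma exp_minus_le_inverse_power:
  fixes x :: real
  assumes "x > 0"
  shows "exp (- x) \<le> fact j / x ^ j"
proof -
  obtain t where "exp x = (\<Sum>m<Suc j. x ^ m / fact m) + exp t / fact (Suc j) * x ^ Suc j"
    using Maclaurin_exp_le[of x "Suc j"] by blast
  moreover have "(\<Sum>m<j. x ^ m / fact m) \<ge> 0" "exp t / fact (Suc j) * x ^ Suc j \<ge> 0"
    using assms by (auto intro!: sum_nonneg simp del: fact_Suc)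
  ultimately have "x ^ j / fact j \<le> exp x" by simp
  then show ?thesis
    using assms by (simp add: exp_minus field_simps)
qed

lemma abs_exp_minus_diff_le:
  fixes a b c :: real
  assumes "c \<le> a" "c \<le> b"
  shows "\<bar>exp (- a) - exp (- b)\<bar> \<le> \<bar>a - b\<bar> * exp (- c)"
proof -
  have *: "exp (- a) - exp (- b) \<le> (b - a) * exp (- c)" if "c \<le> a" "a \<le> b" for a b
  proof -
    have "1 - exp (- (b - a)) \<le> b - a"
      using exp_ge_add_one_self[of "- (b - a)"] by linarith
    then have "exp (- a) * (1 - exp (- (b - a))) \<le> exp (- c) * (b - a)"
      using that by (intro mult_mono) auto
    then show ?thesis by (simp add: exp_add[symmetric] algebra_simps)
  qed
  show ?thesis
  proof (cases "a \<le> b")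
    case True
    then show ?thesis using *[of a b] assms by (simp add: abs_if)
  next
    case False
    then show ?thesis using *[of b a] assms by (simp add: abs_if)
  qed
qed

lemma has_integral_abs_bound:
  fixes f g :: "'a::euclidean_space \<Rightarrow> real"
  assumes "(f has_integral I) S" "(g has_integral J) S" "\<And>x. x \<in> S \<Longrightarrow> \<bar>f x\<bar> \<le> g x"
  shows "\<bar>I\<bar> \<le> J"
proof -
  have "norm (integral S f) \<le> integral S g"
    using assms by (intro integral_norm_bound_integral) auto
  then show ?thesis using assms(1,2) by (simp add: integral_unique)
qed

section \<open>Laplace's method\<close>

text \<open>
  Outside a neighbourhood of \<open>0\<close> the phase \<open>e\<^sup>y - 1 - y\<close> is at least some \<open>m > 0\<close>, so the integrand
  for \<open>n\<close> is at most \<open>e\<^bsup>-(n-1)m\<^esup>\<close> times the integrand for \<open>1\<close>; this decays faster than any power.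
\<close>
lemma exp_phase_tail:
  fixes p q :: real
  assumes "p < 0" "0 < q"
  obtains C where "C \<ge> 0"
    "\<And>n::nat. n \<ge> 1 \<Longrightarrow> \<bar>fact n * exp (real n) / real n ^ (n + 1) -
       integral {p..q} (\<lambda>y. exp (- real n * (exp y - 1 - y)))\<bar> \<le> C / real n ^ j"
proof -
  define \<phi> :: "real \<Rightarrow> real" where "\<phi> = (\<lambda>y. exp y - 1 - y)"
  define m where "m = min (\<phi> p) (\<phi> q)"
  have m: "m > 0"
    unfolding m_def \<phi>_def using exp_phase_pos[of p] exp_phase_pos[of q] assms by simp
  have \<phi>_ge: "\<phi> y \<ge> m" if "y \<notin> {p..q}" for y
    using that assms exp_phase_mono[of p y] exp_phase_mono[of q y]
    by (auto simp: m_def \<phi>_def min_le_iff_disj)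
  show thesis
  proof (rule that[of "exp m * (fact j / m ^ j) * exp 1"])
    show "exp m * (fact j / m ^ j) * exp 1 \<ge> 0" using m by simp
    fix n :: nat assume n: "n \<ge> 1"
    let ?f = "\<lambda>y. exp (- real n * \<phi> y)"
    let ?I = "fact n * exp (real n) / real n ^ (n + 1)"
    have "(?f has_integral integral {p..q} ?f) {p..q}"
      unfolding \<phi>_def by (intro integrable_integral integrable_continuous_interval continuous_intros)
    then have "((\<lambda>y. if y \<in> {p..q} then ?f y else 0) has_integral integral {p..q} ?f) UNIV"
      by (subst has_integral_restrict_UNIV)
    moreover have "(?f has_integral ?I) UNIV"
      using fact_eq_integral_exp[OF n] by (simp add: \<phi>_def)
    ultimately have F: "((\<lambda>y. ?f y - (if y \<in> {p..q} then ?f y else 0)) has_integral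
        ?I - integral {p..q} ?f) UNIV"
      by (rule has_integral_diff[rotated])
    have G: "((\<lambda>y. exp (- (real n - 1) * m) * exp (- \<phi> y)) has_integral
        exp (- (real n - 1) * m) * exp 1) UNIV"
      using has_integral_mult_right[OF fact_eq_integral_exp[of 1]] by (simp add: \<phi>_def)
    have "norm (?f y - (if y \<in> {p..q} then ?f y else 0)) \<le>
        exp (- (real n - 1) * m) * exp (- \<phi> y)" for y
    proof (cases "y \<in> {p..q}")
      case False
      have "(real n - 1) * m \<le> (real n - 1) * \<phi> y"
        using \<phi>_ge[OF False] n by (intro mult_left_mono) auto
      with False show ?thesis by (simp add: exp_add[symmetric] algebra_simps)
    qed auto
    then have "\<bar>?I - integral {p..q} ?f\<bar> \<le> exp (- (real n - 1) * m) * exp 1"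
      by (intro has_integral_abs_bound[OF F G]) (simp only: real_norm_def)
    also have "exp (- (real n - 1) * m) = exp m * exp (- (real n * m))"
      by (simp add: exp_add[symmetric] algebra_simps)
    also have "\<dots> \<le> exp m * (fact j / (real n * m) ^ j)"
      using m n by (intro mult_left_mono exp_minus_le_inverse_power) auto
    finally show "\<bar>?I - integral {p..q} (\<lambda>y. exp (- real n * (exp y - 1 - y)))\<bar>
        \<le> exp m * (fact j / m ^ j) * exp 1 / real n ^ j"
      using m n by (simp add: \<phi>_def power_mult_distrib mult_ac)
  qed
qed

text \<open>
  Substitute \<open>y = p(u)\<close> on a small interval \<open>[-d, d]\<close> and replace the phase by \<open>u\<^sup>2/2\<close>. The
  substituted integrand differs from \<open>p'(u) e\<^bsup>-nu\<^sup>2/2\<^esup>\<close> by at most a multiple of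
  \<open>n u\<^bsup>2N+4\<^esup> e\<^bsup>-nu\<^sup>2/4\<^esup>\<close> inside the interval, and outside it the latter is at most a
  multiple of \<open>u\<^bsup>2N+2\<^esup> e\<^bsup>-nu\<^sup>2/2\<^esup>\<close>. Integrated over the line, both bounds are of order
  \<open>n\<^bsup>-1/2-(N+1)\<^esup>\<close>, and the Gaussian integral of \<open>p'\<close> is the main term.
\<close>
lemma exp_phase_local_expansion:
  fixes p :: "real poly"
  assumes p0: "coeff p 0 = 0" and p1: "coeff p 1 = 1" and deg: "degree p \<le> 2 * N + 2"
    and coeffs: "\<And>n. n < 2 * N + 4 \<Longrightarrow>
      coeff (\<Sum>j=2..<2*N+4. smult (1 / fact j) (p ^ j)) n = coeff (monom (1/2) 2) n"
  obtains a b C where "a < 0" "0 < b" "C \<ge> 0"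
    "\<And>n::nat. n \<ge> 1 \<Longrightarrow>
       \<bar>integral {a..b} (\<lambda>y. exp (- real n * (exp y - 1 - y))) -
        sqrt (2 * pi / real n) * (\<Sum>k<Suc N. coeff (pderiv p) (2 * k) * fact (2 * k) /
          ((2 * real n) ^ k * fact k))\<bar> \<le> C / (sqrt (real n) * real n ^ (N + 1))"
proof -
  define \<phi> :: "real \<Rightarrow> real" where "\<phi> = (\<lambda>y. exp y - 1 - y)"
  obtain K where K: "K \<ge> 0"
    "\<And>u. \<bar>u\<bar> \<le> 1 \<Longrightarrow> \<bar>\<phi> (poly p u) - u\<^sup>2 / 2\<bar> \<le> K * \<bar>u\<bar> ^ (2 * N + 4)"
    using exp_poly_remainder[OF p0 _ coeffs] unfolding \<phi>_def by auto
  have "monom 1 1 dvd p"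
    unfolding monom_1_dvd_iff' using p0 by simp
  then obtain t where t: "p = monom 1 1 * t" by (auto elim: dvdE)
  have t0: "poly t 0 = 1" using p1 by (simp add: t coeff_monom_mult poly_0_coeff_0)
  \<comment> \<open>The bound on \<open>K d\<close> keeps the phase above \<open>u\<^sup>2/4\<close>; since \<open>p(u) = u t(u)\<close>, positivity of
      \<open>t\<close> at both end points makes the image interval contain \<open>0\<close> in its interior.\<close>
  have ev: "\<forall>\<^sub>F d in at_right 0. d > 0 \<and> d \<le> 1 \<and> K * d < 1/4 \<and> poly t d > 0 \<and> poly t (- d) > 0"
  proof (intro eventually_conj)
    show "\<forall>\<^sub>F d in at_right 0. d > (0::real)" by (simp add: eventually_at_right_less)
    show "\<forall>\<^sub>F d in at_right 0. d \<le> (1::real)"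
      by (rule eventually_at_rightI[of 0 1]) auto
    have "((\<lambda>d. K * d) \<longlongrightarrow> K * 0) (at_right 0)" by (intro tendsto_intros)
    then show "\<forall>\<^sub>F d in at_right 0. K * d < 1/4"
      by (rule order_tendstoD(2)) simp
    have "((\<lambda>d. poly t d) \<longlongrightarrow> poly t 0) (at_right 0)" by (intro tendsto_intros)
    then show "\<forall>\<^sub>F d in at_right 0. poly t d > 0"
      by (rule order_tendstoD(1)) (simp add: t0)
    have "((\<lambda>d. poly t (- d)) \<longlongrightarrow> poly t (- 0)) (at_right 0)" by (intro tendsto_intros)
    then show "\<forall>\<^sub>F d in at_right 0. poly t (- d) > 0"
      by (rule order_tendstoD(1)) (simp add: t0)
  qed
  obtain d where d: "d > 0" "d \<le> 1" "K * d < 1/4" "poly t d > 0" "poly t (- d) > 0"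
    using eventually_happens'[OF _ ev] by auto
  have ab: "poly p (- d) < 0" "0 < poly p d"
    using d by (simp_all add: t poly_monom mult_neg_pos)
  have \<phi>_ge: "\<phi> (poly p u) \<ge> u\<^sup>2 / 4" if u: "\<bar>u\<bar> \<le> d" for u
  proof -
    have "K * \<bar>u\<bar> ^ (2 * N + 4) \<le> K * (d * u\<^sup>2)"
    proof (rule mult_left_mono)
      have "\<bar>u\<bar> ^ (2 * N + 4) = \<bar>u\<bar> ^ (2 * N + 1) * \<bar>u\<bar> * \<bar>u\<bar>\<^sup>2"
        by (simp only: power_add[symmetric] power_Suc2[symmetric]) (simp add: numeral_eq_Suc)
      also have "\<dots> \<le> 1 * d * \<bar>u\<bar>\<^sup>2"
        using u d by (intro mult_mono power_le_one) auto
      finally show "\<bar>u\<bar> ^ (2 * N + 4) \<le> d * u\<^sup>2" by simp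
    qed (rule K)
    also have "\<dots> \<le> 1/4 * u\<^sup>2"
      using d(3) by (subst mult.assoc[symmetric]) (intro mult_right_mono, auto)
    finally show ?thesis using K(2)[of u] u d by (simp add: abs_le_iff)
  qed
  obtain D where D: "D \<ge> 0" "\<And>u. \<bar>u\<bar> \<le> 1 \<Longrightarrow> \<bar>poly (pderiv p) u\<bar> \<le> D"
    using poly_bounded_unit_interval[of "pderiv p"] by blast
  have "degree (pderiv p) \<le> 2 * (N + 1)" using deg by (simp add: degree_pderiv)
  then obtain L where L: "L \<ge> 0" "\<And>u. \<bar>u\<bar> \<ge> d \<Longrightarrow> \<bar>poly (pderiv p) u\<bar> \<le> L * \<bar>u\<bar> ^ (2 * (N + 1))"
    using poly_bound_outside[OF _ d(1)] by blast
  define c1 where "c1 = fact (2 * (N + 2)) / fact (N + 2) * sqrt (4 * pi) * (K * D)"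
  define c2 where "c2 = fact (2 * (N + 1)) / (2 ^ (N + 1) * fact (N + 1)) * sqrt (2 * pi) * L"
  show thesis
  proof (rule that[OF ab, of "c1 + c2"])
    show "c1 + c2 \<ge> 0" using K D L by (simp add: c1_def c2_def)
    fix n :: nat assume "n \<ge> 1"
    then have n: "real n > 0" by simp
    let ?f = "\<lambda>y. exp (- real n * \<phi> y)" and ?P = "poly (pderiv p)"
    let ?I = "integral {poly p (- d)..poly p d} ?f"
    let ?S = "sqrt (2 * pi / real n) * (\<Sum>k<Suc N. coeff (pderiv p) (2 * k) * fact (2 * k) /
          ((2 * real n) ^ k * fact k))"
    have "compact (poly p ` {- d..d})"
      by (intro compact_continuous_image continuous_intros) auto
    then obtain r where r: "poly p ` {- d..d} \<subseteq> {- r..r}"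
      using compact_imp_bounded bounded_subset_cbox_symmetric by (metis interval_cbox)
    have "((\<lambda>u. ?P u *\<^sub>R ?f (poly p u)) has_integral ?I) {- d..d}"
      using ab d r by (intro has_integral_substitution[where c = "- r" and d = r])
        (auto simp: \<phi>_def intro!: continuous_intros poly_DERIV[THEN has_field_derivative_at_within])
    then have "((\<lambda>u. if u \<in> {- d..d} then ?P u * ?f (poly p u) else 0) has_integral ?I) UNIV"
      by (subst has_integral_restrict_UNIV) simp
    moreover have "((\<lambda>u. exp (- real n * u\<^sup>2 / 2) * ?P u) has_integral ?S) UNIV"
      using deg by (intro gaussian_integral_poly n) (simp add: degree_pderiv)
    ultimately have F: "((\<lambda>u. (if u \<in> {- d..d} then ?P u * ?f (poly p u) else 0) -
        exp (- real n * u\<^sup>2 / 2) * ?P u) has_integral ?I - ?S) UNIV"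
      by (rule has_integral_diff)
    let ?G = "\<lambda>u. real n * (K * D) * (exp (- (real n / 2) * u\<^sup>2 / 2) * u ^ (2 * (N + 2))) +
         L * (exp (- real n * u\<^sup>2 / 2) * u ^ (2 * (N + 1)))"
    have G: "(?G has_integral
        real n * (K * D) * (sqrt (2 * pi / (real n / 2)) *
          (fact (2 * (N + 2)) / ((2 * (real n / 2)) ^ (N + 2) * fact (N + 2)))) +
        L * (sqrt (2 * pi / real n) *
          (fact (2 * (N + 1)) / ((2 * real n) ^ (N + 1) * fact (N + 1))))) UNIV"
      by (intro has_integral_add has_integral_mult_right gaussian_moment_even) (use n in auto)
    have "norm ((if u \<in> {- d..d} then ?P u * ?f (poly p u) else 0) -
        exp (- real n * u\<^sup>2 / 2) * ?P u) \<le> ?G u" for u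
    proof (cases "\<bar>u\<bar> \<le> d")
      case True
      have "\<bar>exp (- (real n * \<phi> (poly p u))) - exp (- (real n * u\<^sup>2 / 2))\<bar> \<le>
          \<bar>real n * \<phi> (poly p u) - real n * u\<^sup>2 / 2\<bar> * exp (- (real n * u\<^sup>2 / 4))"
        using \<phi>_ge[OF True] n
        by (intro abs_exp_minus_diff_le) (auto intro: mult_left_mono)
      also have "\<bar>real n * \<phi> (poly p u) - real n * u\<^sup>2 / 2\<bar> = real n * \<bar>\<phi> (poly p u) - u\<^sup>2 / 2\<bar>"
      proof -
        have "real n * \<phi> (poly p u) - real n * u\<^sup>2 / 2 = real n * (\<phi> (poly p u) - u\<^sup>2 / 2)"
          by (simp add: right_diff_distrib)
        then show ?thesis by (simp only: abs_mult abs_of_nat)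
      qed
      also have "\<dots> \<le> real n * (K * u ^ (2 * (N + 2)))"
      proof (rule mult_left_mono)
        have "2 * N + 4 = 2 * (N + 2)" by simp
        then have "\<bar>u\<bar> ^ (2 * N + 4) = u ^ (2 * (N + 2))" by (simp only: power_even_abs even_mult_iff even_numeral simp_thms)
        then show "\<bar>\<phi> (poly p u) - u\<^sup>2 / 2\<bar> \<le> K * u ^ (2 * (N + 2))"
          using K(2)[of u] True d by simp
      qed simp
      finally have "\<bar>exp (- (real n * \<phi> (poly p u))) - exp (- (real n * u\<^sup>2 / 2))\<bar> * \<bar>?P u\<bar> \<le>
          (real n * (K * u ^ (2 * (N + 2))) * exp (- (real n * u\<^sup>2 / 4))) * D"
        using D(2)[of u] True d by (intro mult_mono) auto
      then have "\<bar>?P u * ?f (poly p u) - exp (- real n * u\<^sup>2 / 2) * ?P u\<bar> \<le>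
          real n * (K * D) * (exp (- (real n / 2) * u\<^sup>2 / 2) * u ^ (2 * (N + 2)))"
        unfolding abs_mult[symmetric] by (simp add: algebra_simps)
      moreover have "0 \<le> L * (exp (- real n * u\<^sup>2 / 2) * u ^ (2 * (N + 1)))"
        using L(1) by (intro mult_nonneg_nonneg zero_le_even_power) auto
      ultimately show ?thesis using True by (simp add: abs_le_iff)
    next
      case False
      then have "exp (- real n * u\<^sup>2 / 2) * \<bar>?P u\<bar> \<le>
          exp (- real n * u\<^sup>2 / 2) * (L * \<bar>u\<bar> ^ (2 * (N + 1)))"
        by (intro mult_left_mono L(2)) auto
      moreover have "0 \<le> real n * (K * D) * (exp (- (real n / 2) * u\<^sup>2 / 2) * u ^ (2 * (N + 2)))"
        using K(1) D(1) by (intro mult_nonneg_nonneg zero_le_even_power) auto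
      moreover have "\<bar>u\<bar> ^ (2 * (N + 1)) = u ^ (2 * (N + 1))"
        by (simp only: power_even_abs even_mult_iff even_numeral simp_thms)
      moreover have "norm ((if u \<in> {- d..d} then ?P u * ?f (poly p u) else 0) -
          exp (- real n * u\<^sup>2 / 2) * ?P u) = exp (- real n * u\<^sup>2 / 2) * \<bar>?P u\<bar>"
        using False by (auto simp: abs_mult)
      ultimately show ?thesis by (simp only: mult.left_commute[of L])
    qed
    then have "\<bar>?I - ?S\<bar> \<le> real n * (K * D) * (sqrt (2 * pi / (real n / 2)) *
          (fact (2 * (N + 2)) / ((2 * (real n / 2)) ^ (N + 2) * fact (N + 2)))) +
        L * (sqrt (2 * pi / real n) *
          (fact (2 * (N + 1)) / ((2 * real n) ^ (N + 1) * fact (N + 1))))"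
      by (intro has_integral_abs_bound[OF F G]) (simp only: real_norm_def)
    also have "\<dots> = (c1 + c2) / (sqrt (real n) * real n ^ (N + 1))"
    proof -
      have "x * (K * D) * (sqrt (2 * pi / (x / 2)) * (A / ((2 * (x / 2)) ^ (N + 2) * B))) =
          A / B * sqrt (4 * pi) * (K * D) / (sqrt x * x ^ (N + 1))" if "x > 0" for A B x :: real
        using that by (simp add: real_sqrt_divide mult_ac)
      from this[OF n] have "real n * (K * D) * (sqrt (2 * pi / (real n / 2)) *
          (fact (2 * (N + 2)) / ((2 * (real n / 2)) ^ (N + 2) * fact (N + 2)))) =
          c1 / (sqrt (real n) * real n ^ (N + 1))"
        unfolding c1_def .
      moreover have "L * (sqrt (2 * pi / x) * (A / ((2 * x) ^ (N + 1) * B))) =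
          A / (2 ^ (N + 1) * B) * sqrt (2 * pi) * L / (sqrt x * x ^ (N + 1))"
        if "x > 0" for A B x :: real
        using that by (simp add: real_sqrt_divide power_mult_distrib mult_ac)
      from this[OF n] have "L * (sqrt (2 * pi / real n) *
          (fact (2 * (N + 1)) / ((2 * real n) ^ (N + 1) * fact (N + 1)))) =
          c2 / (sqrt (real n) * real n ^ (N + 1))"
        unfolding c2_def .
      ultimately show ?thesis by (simp only: add_divide_distrib)
    qed
    finally show "\<bar>integral {poly p (- d)..poly p d} (\<lambda>y. exp (- real n * (exp y - 1 - y))) - ?S\<bar>
      \<le> (c1 + c2) / (sqrt (real n) * real n ^ (N + 1))"
      unfolding \<phi>_def .
  qed
qed

section \<open>The asymptotic expansion and its uniqueness\<close>

text \<open>The coefficients of the expansion of \<open>n!\<close>, defined through the series \<open>B\<close>.\<close>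
definition stirling_coeff :: "nat \<Rightarrow> real" where
  "stirling_coeff k = b_coeff (2 * k + 1) / (2 ^ k * fact k)"

lemma stirling_error_bound:
  obtains C where "C \<ge> 0" "\<And>n::nat. n \<ge> 1 \<Longrightarrow>
    \<bar>fact n * exp (real n) / real n ^ (n + 1) -
     sqrt (2 * pi / real n) * (\<Sum>k=0..N. stirling_coeff k / real n ^ k)\<bar>
      \<le> C / (sqrt (real n) * real n ^ (N + 1))"
proof -
  \<comment> \<open>Truncating after degree \<open>2N + 2\<close> keeps one term more than the main term requires; it lowers the
      error of the phase to order \<open>u\<^bsup>2N+4\<^esup>\<close>, and the extra term of \<open>p'\<close> is odd.\<close>
  define p where "p = B_trunc (2 * N + 2)"
  have p01: "coeff p 0 = 0" "coeff p 1 = 1" by (simp_all add: p_def coeff_B_trunc)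
  have deg: "degree p \<le> 2 * N + 2"
    using degree_truncate_fps[of "2 * N + 2 + 1" B_series] unfolding p_def B_trunc_def by linarith
  have coeffs: "coeff (\<Sum>j=2..<2*N+4. smult (1 / fact j) (p ^ j)) n = coeff (monom (1/2) 2) n"
    if "n < 2 * N + 4" for n
  proof -
    have "2 * N + 4 = (2 * N + 2) + 2" by simp
    with that show ?thesis using B_trunc_exp_coeff[of n "2 * N + 2"] unfolding p_def by metis
  qed
  obtain a b C where ab: "a < 0" "0 < b" "C \<ge> 0" and
    C: "\<And>n::nat. n \<ge> 1 \<Longrightarrow>
       \<bar>integral {a..b} (\<lambda>y. exp (- real n * (exp y - 1 - y))) -
        sqrt (2 * pi / real n) * (\<Sum>k<Suc N. coeff (pderiv p) (2 * k) * fact (2 * k) /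
          ((2 * real n) ^ k * fact k))\<bar> \<le> C / (sqrt (real n) * real n ^ (N + 1))"
    using exp_phase_local_expansion[OF p01 deg coeffs] by blast
  obtain C' where C': "C' \<ge> 0" "\<And>n::nat. n \<ge> 1 \<Longrightarrow>
      \<bar>fact n * exp (real n) / real n ^ (n + 1) -
       integral {a..b} (\<lambda>y. exp (- real n * (exp y - 1 - y)))\<bar> \<le> C' / real n ^ (N + 2)"
    using exp_phase_tail[OF ab(1,2)] by blast
  show thesis
  proof (rule that[of "C' + C"])
    show "C' + C \<ge> 0" using ab C' by simp
    fix n :: nat assume n: "n \<ge> 1"
    have coeff: "coeff (pderiv p) (2 * k) * fact (2 * k) / ((2 * real n) ^ k * fact k) =
        stirling_coeff k / real n ^ k" if "k \<le> N" for k
      using that by (simp add: stirling_coeff_def b_coeff_def coeff_pderiv p_def coeff_B_trunc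
          power_mult_distrib mult_ac)
    have main_term: "(\<Sum>k<Suc N. coeff (pderiv p) (2 * k) * fact (2 * k) / ((2 * real n) ^ k * fact k)) =
        (\<Sum>k=0..N. stirling_coeff k / real n ^ k)"
    proof (rule sum.cong)
      show "{..<Suc N} = {0..N}" by auto
    qed (simp only: coeff atLeastAtMost_iff)
    have "sqrt (real n) \<le> real n"
      using n by (intro real_le_lsqrt) (auto simp: power2_eq_square mult_le_cancel_left1)
    then have "sqrt (real n) * real n ^ (N + 1) \<le> real n ^ (N + 2)"
      by (simp add: mult_right_mono)
    then have "C' / real n ^ (N + 2) \<le> C' / (sqrt (real n) * real n ^ (N + 1))"
      using n C'(1) by (intro divide_left_mono) auto
    then show "\<bar>fact n * exp (real n) / real n ^ (n + 1) -
        sqrt (2 * pi / real n) * (\<Sum>k=0..N. stirling_coeff k / real n ^ k)\<bar>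
        \<le> (C' + C) / (sqrt (real n) * real n ^ (N + 1))"
      using C[OF n, unfolded main_term] C'(2)[OF n] unfolding add_divide_distrib by linarith
  qed
qed

lemma stirling_expansion_stirling_coeff: "stirling_expansion stirling_coeff"
  unfolding stirling_expansion_def
proof
  fix N
  define w where "w n = sqrt (2 * pi * real n) * exp (- real n) * real n ^ n" for n
  define R where "R n = fact n / w n - (\<Sum>k=0..N. stirling_coeff k / real n ^ k)" for n
  obtain C where C: "C \<ge> 0" "\<And>n::nat. n \<ge> 1 \<Longrightarrow>
    \<bar>fact n * exp (real n) / real n ^ (n + 1) -
     sqrt (2 * pi / real n) * (\<Sum>k=0..N. stirling_coeff k / real n ^ k)\<bar>
      \<le> C / (sqrt (real n) * real n ^ (N + 1))"
    using stirling_error_bound[of N] by blast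
  have "norm (R n) \<le> C / sqrt (2 * pi) * norm (1 / real n ^ (N + 1))" if n: "n \<ge> 1" for n
  proof -
    let ?s = "sqrt (2 * pi / real n)"
    have s: "?s > 0" using n by simp
    have "w n \<noteq> 0" using n by (simp add: w_def)
    moreover have "w n = ?s * (real n ^ (n + 1) * exp (- real n))"
      using n by (simp add: w_def real_sqrt_divide real_sqrt_mult field_simps)
    ultimately have "?s * (fact n / w n) = fact n * exp (real n) / real n ^ (n + 1)"
      using s n \<open>w n \<noteq> 0\<close> by (simp add: exp_minus divide_simps mult.commute[of "exp _"])
    then have "?s * R n = fact n * exp (real n) / real n ^ (n + 1) -
        ?s * (\<Sum>k=0..N. stirling_coeff k / real n ^ k)"
      by (simp only: R_def right_diff_distrib)
    moreover have "?s * \<bar>R n\<bar> = \<bar>?s * R n\<bar>"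
      using s by (simp only: abs_mult abs_of_pos)
    ultimately have "?s * \<bar>R n\<bar> = \<bar>fact n * exp (real n) / real n ^ (n + 1) -
        ?s * (\<Sum>k=0..N. stirling_coeff k / real n ^ k)\<bar>"
      by (simp only:)
    also have "\<dots> \<le> C / (sqrt (real n) * real n ^ (N + 1))" by (rule C(2)[OF n])
    finally have "\<bar>R n\<bar> \<le> C / (sqrt (real n) * real n ^ (N + 1)) / ?s"
      unfolding pos_le_divide_eq[OF s] by (simp only: mult.commute)
    also have "\<dots> = C / sqrt (2 * pi) * (1 / real n ^ (N + 1))"
      using n by (simp add: real_sqrt_divide)
    finally show ?thesis by simp
  qed
  then have "R \<in> O(\<lambda>n. 1 / real n ^ (N + 1))"
    by (intro bigoI[of _ "C / sqrt (2 * pi)"] eventually_sequentiallyI[of 1])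
  moreover have "fact n = w n * ((\<Sum>k=0..N. stirling_coeff k / real n ^ k) + R n)" if "n \<ge> 1" for n
    using that by (simp add: R_def w_def)
  ultimately show "\<exists>R. R \<in> O(\<lambda>n. 1 / real n ^ (N + 1)) \<and> (\<forall>n\<ge>1. fact n =
      sqrt (2 * pi * real n) * exp (- real n) * real n ^ n *
        ((\<Sum>k=0..N. stirling_coeff k / real n ^ k) + R n))"
    unfolding w_def by (intro exI[of _ R] conjI allI impI)
qed

lemma stirling_expansion_unique:
  assumes "stirling_expansion a" "stirling_expansion a'"
  shows "a k = a' k"
proof (induction k rule: less_induct)
  case (less N)
  obtain R where R: "R \<in> O(\<lambda>n. 1 / real n ^ (N + 1))"
    and eq: "\<And>n. n \<ge> 1 \<Longrightarrow> fact n = sqrt (2 * pi * real n) * exp (- real n) * real n ^ n *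
               ((\<Sum>k=0..N. a k / real n ^ k) + R n)"
    using assms(1) unfolding stirling_expansion_def by blast
  obtain R' where R': "R' \<in> O(\<lambda>n. 1 / real n ^ (N + 1))"
    and eq': "\<And>n. n \<ge> 1 \<Longrightarrow> fact n = sqrt (2 * pi * real n) * exp (- real n) * real n ^ n *
               ((\<Sum>k=0..N. a' k / real n ^ k) + R' n)"
    using assms(2) unfolding stirling_expansion_def by blast
  have diff: "a N - a' N = real n ^ N * (R' n - R n)" if n: "n \<ge> 1" for n
  proof -
    have "(\<Sum>k=0..N. a k / real n ^ k) + R n = (\<Sum>k=0..N. a' k / real n ^ k) + R' n"
      using eq[OF n] eq'[OF n] n by auto
    moreover have "(\<Sum>k=0..<N. a k / real n ^ k) = (\<Sum>k=0..<N. a' k / real n ^ k)"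
      using less by (intro sum.cong) auto
    ultimately have "a N / real n ^ N + R n = a' N / real n ^ N + R' n"
      by (simp add: atLeastLessThanSuc_atLeastAtMost[symmetric])
    then show ?thesis using n by (simp add: field_simps)
  qed
  have "(\<lambda>n. R' n - R n) \<in> O(\<lambda>n. 1 / real n ^ (N + 1))"
    using R R' by (intro sum_in_bigo)
  then obtain C where "\<forall>\<^sub>F n in sequentially. norm (R' n - R n) \<le> C * norm (1 / real n ^ (N + 1))"
    by (auto elim: landau_o.bigE)
  then have "\<forall>\<^sub>F n in sequentially. \<bar>a N - a' N\<bar> \<le> C * (1 / real n)"
    using eventually_ge_at_top[of 1]
  proof eventually_elim
    case (elim n)
    have "\<bar>a N - a' N\<bar> = real n ^ N * \<bar>R' n - R n\<bar>"
      using diff[OF elim(2)] by (simp add: abs_mult)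
    also have "\<dots> \<le> real n ^ N * (C * (1 / real n ^ (N + 1)))"
      using elim(1) by (intro mult_left_mono) auto
    finally show ?case using elim(2) by simp
  qed
  moreover have "(\<lambda>n. C * (1 / real n)) \<longlonglongrightarrow> C * 0"
    by (intro tendsto_intros lim_1_over_n)
  ultimately have "\<bar>a N - a' N\<bar> \<le> C * 0"
    by (intro tendsto_lowerbound) auto
  then show ?case by simp
qed

lemma fact_odd_eq_double_fact: "fact (2 * k + 1) = real (odd_double_fact k) * (2 ^ k * fact k)"
  by (induction k) (simp_all add: odd_double_fact_def algebra_simps)

theorem mainTheorem5:
  fixes a :: "nat \<Rightarrow> real"
  assumes "stirling_expansion a"
  shows "\<forall>k :: nat.
    a k = b_coeff (2 * k + 1) / (2 ^ k * fact k) \<and>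
    b_coeff (2 * k + 1) / (2 ^ k * fact k) = c_coeff (2 * k + 1) / (2 ^ k * fact k) \<and>
    c_coeff (2 * k + 1) / (2 ^ k * fact k) = real (odd_double_fact k) * b_tilde (2 * k + 1) \<and>
    real (odd_double_fact k) * b_tilde (2 * k + 1) = real (odd_double_fact k) * c_tilde (2 * k + 1)"
proof (intro allI conjI)
  fix k :: nat
  show "a k = b_coeff (2 * k + 1) / (2 ^ k * fact k)"
    using stirling_expansion_unique[OF assms stirling_expansion_stirling_coeff]
    by (simp add: stirling_coeff_def)
  show "b_coeff (2 * k + 1) / (2 ^ k * fact k) = c_coeff (2 * k + 1) / (2 ^ k * fact k)"
    by (simp only: c_coeff_odd)
  have "odd_double_fact k > 0" by (simp add: odd_double_fact_def)
  then show "c_coeff (2 * k + 1) / (2 ^ k * fact k) = real (odd_double_fact k) * b_tilde (2 * k + 1)"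
    unfolding b_tilde_def c_coeff_odd fact_odd_eq_double_fact by simp
  show "real (odd_double_fact k) * b_tilde (2 * k + 1) = real (odd_double_fact k) * c_tilde (2 * k + 1)"
    by (simp only: b_tilde_def c_tilde_def c_coeff_odd)
qed

end
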